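(* Let $T$ be a $\Sigma$-formula and write $\neg A$ for $A\Rightarrow T$. For any formula $A$, the following implications hold: (i) $\vdash^+\neg\neg A$ implies $\vdash^m(\neg\neg A)^T$; (ii) $\vdash^m(\neg\neg A)^T$ if and only if $\vdash^cA$; (iii) $\vdash^m(\neg\neg A)^T$ implies $\mathrm{DNS}_T\vdash^m\neg\neg\neg\neg A$; (iv) $\mathrm{DNS}_T\vdash^m\neg\neg\neg\neg A$ implies $\mathrm{DNS}_T\vdash^m\neg\neg A$; (v) $\mathrm{DNS}_T\vdash^m\neg\neg A$ implies $\vdash^+\neg\neg A$. In particular, $\vdash^+\neg\neg A$ if and only if $\vdash^cA$.
   Context: Formulas are those of first-order predicate logic, built from atomic formulas with $\wedge,\vee,\Rightarrow,\exists,\forall$. A $\Sigma$-formula is a formula containing neither $\Rightarrow$ nor $\forall$. The system $\mathrm{MQC}^+$. Only one formula, a $\Sigma$-formula $T$ fixed once and for all, may occur as an annotation in a derivation. Sequents have the form $\Gamma\vdash_\diamond A$, where $\Gamma$ is a finite context of formulas, and $\diamond$ is either the annotation $T$ (written $\Gamma\vdash_T A$) or absent (written $\Gamma\vdash A$). In the rules below, apart from reset and shift, $\diamond$ is the same in all premises and in the conclusion: - Ax: $\Gamma\vdash_\diamond A$ if $A\in\Gamma$. - $\wedge_I$: from $\Gamma\vdash_\diamond A_1$ and $\Gamma\vdash_\diamond A_2$ infer $\Gamma\vdash_\diamond A_1\wedge A_2$. $\wedge_E^i$ ($i=1,2$): from $\Gamma\vdash_\diamond A_1\wedge A_2$ infer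 $\Gamma\vdash_\diamond A_i$. - $\vee_I^i$: from $\Gamma\vdash_\diamond A_i$ infer $\Gamma\vdash_\diamond A_1\vee A_2$. $\vee_E$: from $\Gamma\vdash_\diamond A_1\vee A_2$, $\Gamma,A_1\vdash_\diamond C$ and $\Gamma,A_2\vdash_\diamond C$ infer $\Gamma\vdash_\diamond C$. - $\Rightarrow_I$: from $\Gamma,A_1\vdash_\diamond A_2$ infer $\Gamma\vdash_\diamond A_1\Rightarrow A_2$. $\Rightarrow_E$: from $\Gamma\vdash_\diamond A_1\Rightarrow A_2$ and $\Gamma\vdash_\diamond A_1$ infer $\Gamma\vdash_\diamond A_2$. - $\forall_I$: from $\Gamma\vdash_\diamond A(x)$ with $x$ fresh infer $\Gamma\vdash_\diamond\forall x A(x)$. $\forall_E$: from $\Gamma\vdash_\diamond\forall xA(x)$ infer $\Gamma\vdash_\diamond A(t)$. - $\exists_I$: from $\Gamma\vdash_\diamond A(t)$ infer $\Gamma\vdash_\diamond\exists xA(x)$. $\exists_E$: from $\Gamma\vdash_\diamond\exists xA(x)$ and $\Gamma,A(x)\vdash_\diamond C$ with $x$ fresh infer $\Gamma\vdash_\diamond C$. - Reset ($\#$): from $\Gamma\vdash_T T$ infer $\Gamma\vdash_\diamond T$ (with $\diamond$ either $T$ or absent). - Shift ($\mathcal S$): from $\Gamma,A\Rightarrow T\vdash_T T$ infer $\Gamma\vdash_T A$. "$x$ fresh" means $x$ is not free in $\Gamma$, in $T$, or (for $\exists_E$) in $C$. The free variables of $T$, if any, are treated as parameters: bound variables of formulas,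 and eigenvariables of $\mathrm{MQC}^+$ and CQC derivations, are chosen distinct from them. $\Gamma\vdash^+A$ means that the unannotated sequent $\Gamma\vdash A$ is derivable in $\mathrm{MQC}^+$ with annotation formula $T$. MQC (minimal predicate logic, derivability $\vdash^m$) is the system with all the rules above except reset and shift, and no annotations. CQC (derivability $\vdash^c$) is classical predicate logic with $\bot$ replaced by $T$: MQC together with $T\Rightarrow A$ and the rule $(A\Rightarrow T)\Rightarrow T\vdash^cA$, for every formula $A$. The schema $\mathrm{DNS}_T$ consists of all instances of $\forall x.\,\neg\neg A(x)\Rightarrow\neg\neg(\forall x.\,A(x))$ and of $(A\Rightarrow\neg\neg B)\Rightarrow\neg\neg(A\Rightarrow B)$, for arbitrary formulas. $\mathrm{DNS}_T\vdash^mB$ means that $B$ is derivable in MQC with all these instances available as additional axioms. Translation: $A^T:=(A_T\Rightarrow T)\Rightarrow T$, where $A_T$ is defined by recursion: $A_T:=A$ for $A$ atomic; $(A\mathbin{\Box}B)_T:=A_T\mathbin{\Box}B_T$ for $\Box\in\{\vee,\wedge\}$; $(A\Rightarrow B)_T:=A_T\Rightarrow B^T$; $(\exists xA)_T:=\exists xA_T$; $(\forall xA)_T:=\forall xA^T$. *)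

theory Defs
  imports Main
begin

text \<open>
  First-order syntax with de Bruijn indices. Free variables are the indices that point beyond all
  enclosing binders. The types \<open>'f\<close> and \<open>'p\<close> supply the function and predicate symbols, a
  symbol used with \<open>n\<close> arguments being an \<open>n\<close>-ary symbol. There is no falsum: its role is
  played by the fixed formula \<open>T\<close>.
\<close>

datatype 'f tm = Var nat | Fun 'f "'f tm list"

datatype ('f, 'p) fm =
    Atom 'p "'f tm list"
  | Conj "('f, 'p) fm" "('f, 'p) fm"
  | Disj "('f, 'p) fm" "('f, 'p) fm"
  | Imp "('f, 'p) fm" "('f, 'p) fm"
  | Ex "('f, 'p) fm"
  | All "('f, 'p) fm"

text \<open>Simultaneous substitution for the free variables.\<close>

primrec sub_tm :: "(nat \<Rightarrow> 'f tm) \<Rightarrow> 'f tm \<Rightarrow> 'f tm" where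
  "sub_tm \<sigma> (Var i) = \<sigma> i"
| "sub_tm \<sigma> (Fun f ts) = Fun f (map (sub_tm \<sigma>) ts)"

definition lift_tm :: "'f tm \<Rightarrow> 'f tm" where
  "lift_tm t = sub_tm (\<lambda>i. Var (Suc i)) t"

definition up :: "(nat \<Rightarrow> 'f tm) \<Rightarrow> nat \<Rightarrow> 'f tm" where
  "up \<sigma> = case_nat (Var 0) (\<lambda>i. lift_tm (\<sigma> i))"

primrec sub_fm :: "(nat \<Rightarrow> 'f tm) \<Rightarrow> ('f, 'p) fm \<Rightarrow> ('f, 'p) fm" where
  "sub_fm \<sigma> (Atom p ts) = Atom p (map (sub_tm \<sigma>) ts)"
| "sub_fm \<sigma> (Conj A B) = Conj (sub_fm \<sigma> A) (sub_fm \<sigma> B)"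
| "sub_fm \<sigma> (Disj A B) = Disj (sub_fm \<sigma> A) (sub_fm \<sigma> B)"
| "sub_fm \<sigma> (Imp A B) = Imp (sub_fm \<sigma> A) (sub_fm \<sigma> B)"
| "sub_fm \<sigma> (Ex A) = Ex (sub_fm (up \<sigma>) A)"
| "sub_fm \<sigma> (All A) = All (sub_fm (up \<sigma>) A)"

text \<open>
  \<open>lift_fm A\<close> is \<open>A\<close> read in a scope with one additional variable, numbered \<open>0\<close>, which is not
  free in it. If \<open>All A\<close> stands for \<open>\<forall>x. A(x)\<close>, then \<open>inst A t\<close> stands for \<open>A(t)\<close>.
\<close>

definition lift_fm :: "('f, 'p) fm \<Rightarrow> ('f, 'p) fm" where
  "lift_fm A = sub_fm (\<lambda>i. Var (Suc i)) A"

definition inst :: "('f, 'p) fm \<Rightarrow> 'f tm \<Rightarrow> ('f, 'p) fm" where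
  "inst A t = sub_fm (case_nat t Var) A"

primrec sigma :: "('f, 'p) fm \<Rightarrow> bool" where
  "sigma (Atom p ts) \<longleftrightarrow> True"
| "sigma (Conj A B) \<longleftrightarrow> sigma A \<and> sigma B"
| "sigma (Disj A B) \<longleftrightarrow> sigma A \<and> sigma B"
| "sigma (Imp A B) \<longleftrightarrow> False"
| "sigma (Ex A) \<longleftrightarrow> sigma A"
| "sigma (All A) \<longleftrightarrow> False"

definition neg :: "('f, 'p) fm \<Rightarrow> ('f, 'p) fm \<Rightarrow> ('f, 'p) fm" where
  "neg T A = Imp A T"

text \<open>
  Minimal predicate logic. In \<open>AllI\<close> and \<open>ExE\<close> the eigenvariable is the variable \<open>0\<close> of the
  extended scope; lifting \<open>\<Gamma>\<close> and \<open>C\<close> expresses that it is fresh for them.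
\<close>

inductive mqc :: "('f, 'p) fm list \<Rightarrow> ('f, 'p) fm \<Rightarrow> bool" where
  Ax: "A \<in> set \<Gamma> \<Longrightarrow> mqc \<Gamma> A"
| ConjI: "mqc \<Gamma> A \<Longrightarrow> mqc \<Gamma> B \<Longrightarrow> mqc \<Gamma> (Conj A B)"
| ConjE1: "mqc \<Gamma> (Conj A B) \<Longrightarrow> mqc \<Gamma> A"
| ConjE2: "mqc \<Gamma> (Conj A B) \<Longrightarrow> mqc \<Gamma> B"
| DisjI1: "mqc \<Gamma> A \<Longrightarrow> mqc \<Gamma> (Disj A B)"
| DisjI2: "mqc \<Gamma> B \<Longrightarrow> mqc \<Gamma> (Disj A B)"
| DisjE: "mqc \<Gamma> (Disj A B) \<Longrightarrow> mqc (A # \<Gamma>) C \<Longrightarrow> mqc (B # \<Gamma>) C \<Longrightarrow> mqc \<Gamma> C"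
| ImpI: "mqc (A # \<Gamma>) B \<Longrightarrow> mqc \<Gamma> (Imp A B)"
| ImpE: "mqc \<Gamma> (Imp A B) \<Longrightarrow> mqc \<Gamma> A \<Longrightarrow> mqc \<Gamma> B"
| AllI: "mqc (map lift_fm \<Gamma>) A \<Longrightarrow> mqc \<Gamma> (All A)"
| AllE: "mqc \<Gamma> (All A) \<Longrightarrow> mqc \<Gamma> (inst A t)"
| ExI: "mqc \<Gamma> (inst A t) \<Longrightarrow> mqc \<Gamma> (Ex A)"
| ExE: "mqc \<Gamma> (Ex A) \<Longrightarrow> mqc (A # map lift_fm \<Gamma>) (lift_fm C) \<Longrightarrow> mqc \<Gamma> C"

text \<open>
  In the systems that depend on \<open>T\<close>, the formula \<open>T\<close> is lifted together with the context, which
  expresses that its free variables are parameters: eigenvariables and bound variables are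
  distinct from them. Up to this change of scope \<open>T\<close> is the same formula throughout a derivation.

  The double-negation-shift schema: the instances of
  \<open>\<forall>x. \<not>\<not>A(x) \<Rightarrow> \<not>\<not>(\<forall>x. A(x))\<close>, where the antecedent is \<open>\<forall>x. \<not>\<not>A(x)\<close>, and of
  \<open>(A \<Rightarrow> \<not>\<not>B) \<Rightarrow> \<not>\<not>(A \<Rightarrow> B)\<close>.
\<close>

definition DNS :: "('f, 'p) fm \<Rightarrow> ('f, 'p) fm set" where
  "DNS T =
     {Imp (All (neg (lift_fm T) (neg (lift_fm T) A))) (neg T (neg T (All A))) | A. True} \<union>
     {Imp (Imp A (neg T (neg T B))) (neg T (neg T (Imp A B))) | A B. True}"

text \<open>\<open>mqc_dns T \<Gamma> A\<close>: derivability in minimal logic with all members of \<open>DNS T\<close> as axioms.\<close>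

inductive mqc_dns :: "('f, 'p) fm \<Rightarrow> ('f, 'p) fm list \<Rightarrow> ('f, 'p) fm \<Rightarrow> bool" where
  Ax: "A \<in> set \<Gamma> \<Longrightarrow> mqc_dns T \<Gamma> A"
| ConjI: "mqc_dns T \<Gamma> A \<Longrightarrow> mqc_dns T \<Gamma> B \<Longrightarrow> mqc_dns T \<Gamma> (Conj A B)"
| ConjE1: "mqc_dns T \<Gamma> (Conj A B) \<Longrightarrow> mqc_dns T \<Gamma> A"
| ConjE2: "mqc_dns T \<Gamma> (Conj A B) \<Longrightarrow> mqc_dns T \<Gamma> B"
| DisjI1: "mqc_dns T \<Gamma> A \<Longrightarrow> mqc_dns T \<Gamma> (Disj A B)"
| DisjI2: "mqc_dns T \<Gamma> B \<Longrightarrow> mqc_dns T \<Gamma> (Disj A B)"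
| DisjE: "mqc_dns T \<Gamma> (Disj A B) \<Longrightarrow> mqc_dns T (A # \<Gamma>) C \<Longrightarrow> mqc_dns T (B # \<Gamma>) C \<Longrightarrow> mqc_dns T \<Gamma> C"
| ImpI: "mqc_dns T (A # \<Gamma>) B \<Longrightarrow> mqc_dns T \<Gamma> (Imp A B)"
| ImpE: "mqc_dns T \<Gamma> (Imp A B) \<Longrightarrow> mqc_dns T \<Gamma> A \<Longrightarrow> mqc_dns T \<Gamma> B"
| AllI: "mqc_dns (lift_fm T) (map lift_fm \<Gamma>) A \<Longrightarrow> mqc_dns T \<Gamma> (All A)"
| AllE: "mqc_dns T \<Gamma> (All A) \<Longrightarrow> mqc_dns T \<Gamma> (inst A t)"
| ExI: "mqc_dns T \<Gamma> (inst A t) \<Longrightarrow> mqc_dns T \<Gamma> (Ex A)"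
| ExE: "mqc_dns T \<Gamma> (Ex A) \<Longrightarrow> mqc_dns (lift_fm T) (A # map lift_fm \<Gamma>) (lift_fm C) \<Longrightarrow> mqc_dns T \<Gamma> C"
| DNS: "A \<in> DNS T \<Longrightarrow> mqc_dns T \<Gamma> A"

text \<open>Classical logic with \<open>\<bottom>\<close> replaced by \<open>T\<close>.\<close>

inductive cqc :: "('f, 'p) fm \<Rightarrow> ('f, 'p) fm list \<Rightarrow> ('f, 'p) fm \<Rightarrow> bool" where
  Ax: "A \<in> set \<Gamma> \<Longrightarrow> cqc T \<Gamma> A"
| ConjI: "cqc T \<Gamma> A \<Longrightarrow> cqc T \<Gamma> B \<Longrightarrow> cqc T \<Gamma> (Conj A B)"
| ConjE1: "cqc T \<Gamma> (Conj A B) \<Longrightarrow> cqc T \<Gamma> A"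
| ConjE2: "cqc T \<Gamma> (Conj A B) \<Longrightarrow> cqc T \<Gamma> B"
| DisjI1: "cqc T \<Gamma> A \<Longrightarrow> cqc T \<Gamma> (Disj A B)"
| DisjI2: "cqc T \<Gamma> B \<Longrightarrow> cqc T \<Gamma> (Disj A B)"
| DisjE: "cqc T \<Gamma> (Disj A B) \<Longrightarrow> cqc T (A # \<Gamma>) C \<Longrightarrow> cqc T (B # \<Gamma>) C \<Longrightarrow> cqc T \<Gamma> C"
| ImpI: "cqc T (A # \<Gamma>) B \<Longrightarrow> cqc T \<Gamma> (Imp A B)"
| ImpE: "cqc T \<Gamma> (Imp A B) \<Longrightarrow> cqc T \<Gamma> A \<Longrightarrow> cqc T \<Gamma> B"
| AllI: "cqc (lift_fm T) (map lift_fm \<Gamma>) A \<Longrightarrow> cqc T \<Gamma> (All A)"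
| AllE: "cqc T \<Gamma> (All A) \<Longrightarrow> cqc T \<Gamma> (inst A t)"
| ExI: "cqc T \<Gamma> (inst A t) \<Longrightarrow> cqc T \<Gamma> (Ex A)"
| ExE: "cqc T \<Gamma> (Ex A) \<Longrightarrow> cqc (lift_fm T) (A # map lift_fm \<Gamma>) (lift_fm C) \<Longrightarrow> cqc T \<Gamma> C"
| EFQ: "cqc T \<Gamma> (Imp T A)"
| DNE: "cqc T \<Gamma> (neg T (neg T A)) \<Longrightarrow> cqc T \<Gamma> A"

text \<open>
  \<open>mqc_plus T Annotated \<Gamma> A\<close> stands for \<open>\<Gamma> \<turnstile>\<^sub>T A\<close> and \<open>mqc_plus T Plain \<Gamma> A\<close> for the
  unannotated \<open>\<Gamma> \<turnstile> A\<close>.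
\<close>

datatype annotation = Plain | Annotated

inductive mqc_plus :: "('f, 'p) fm \<Rightarrow> annotation \<Rightarrow> ('f, 'p) fm list \<Rightarrow> ('f, 'p) fm \<Rightarrow> bool" where
  Ax: "A \<in> set \<Gamma> \<Longrightarrow> mqc_plus T d \<Gamma> A"
| ConjI: "mqc_plus T d \<Gamma> A \<Longrightarrow> mqc_plus T d \<Gamma> B \<Longrightarrow> mqc_plus T d \<Gamma> (Conj A B)"
| ConjE1: "mqc_plus T d \<Gamma> (Conj A B) \<Longrightarrow> mqc_plus T d \<Gamma> A"
| ConjE2: "mqc_plus T d \<Gamma> (Conj A B) \<Longrightarrow> mqc_plus T d \<Gamma> B"
| DisjI1: "mqc_plus T d \<Gamma> A \<Longrightarrow> mqc_plus T d \<Gamma> (Disj A B)"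
| DisjI2: "mqc_plus T d \<Gamma> B \<Longrightarrow> mqc_plus T d \<Gamma> (Disj A B)"
| DisjE: "mqc_plus T d \<Gamma> (Disj A B) \<Longrightarrow> mqc_plus T d (A # \<Gamma>) C \<Longrightarrow> mqc_plus T d (B # \<Gamma>) C \<Longrightarrow> mqc_plus T d \<Gamma> C"
| ImpI: "mqc_plus T d (A # \<Gamma>) B \<Longrightarrow> mqc_plus T d \<Gamma> (Imp A B)"
| ImpE: "mqc_plus T d \<Gamma> (Imp A B) \<Longrightarrow> mqc_plus T d \<Gamma> A \<Longrightarrow> mqc_plus T d \<Gamma> B"
| AllI: "mqc_plus (lift_fm T) d (map lift_fm \<Gamma>) A \<Longrightarrow> mqc_plus T d \<Gamma> (All A)"
| AllE: "mqc_plus T d \<Gamma> (All A) \<Longrightarrow> mqc_plus T d \<Gamma> (inst A t)"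
| ExI: "mqc_plus T d \<Gamma> (inst A t) \<Longrightarrow> mqc_plus T d \<Gamma> (Ex A)"
| ExE: "mqc_plus T d \<Gamma> (Ex A) \<Longrightarrow> mqc_plus (lift_fm T) d (A # map lift_fm \<Gamma>) (lift_fm C) \<Longrightarrow> mqc_plus T d \<Gamma> C"
| Reset: "mqc_plus T Annotated \<Gamma> T \<Longrightarrow> mqc_plus T d \<Gamma> T"
| Shift: "mqc_plus T Annotated (Imp A T # \<Gamma>) T \<Longrightarrow> mqc_plus T Annotated \<Gamma> A"

text \<open>\<open>trans_sub T A\<close> is the subscript translation \<open>A\<^sub>T\<close>, \<open>trans_sup T A\<close> is \<open>A\<^sup>T\<close>.\<close>

primrec trans_sub :: "('f, 'p) fm \<Rightarrow> ('f, 'p) fm \<Rightarrow> ('f, 'p) fm" where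
  "trans_sub T (Atom p ts) = Atom p ts"
| "trans_sub T (Conj A B) = Conj (trans_sub T A) (trans_sub T B)"
| "trans_sub T (Disj A B) = Disj (trans_sub T A) (trans_sub T B)"
| "trans_sub T (Imp A B) = Imp (trans_sub T A) (Imp (Imp (trans_sub T B) T) T)"
| "trans_sub T (Ex A) = Ex (trans_sub (lift_fm T) A)"
| "trans_sub T (All A) = All (Imp (Imp (trans_sub (lift_fm T) A) (lift_fm T)) (lift_fm T))"

definition trans_sup :: "('f, 'p) fm \<Rightarrow> ('f, 'p) fm \<Rightarrow> ('f, 'p) fm" where
  "trans_sup T A = Imp (Imp (trans_sub T A) T) T"

end

theory Submission
  imports Defs
begin

text \<open>
  All implications follow from a cycle. Shift and reset are classically valid, so
  \<open>\<turnstile>\<^sup>+ \<not>\<not>A\<close> gives \<open>\<turnstile>\<^sup>c A\<close>. The translation interprets classical logic in minimal logic, since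
  \<open>T\<^sub>T = T\<close> for a \<open>\<Sigma>\<close>-formula \<open>T\<close>. In the presence of DNS, \<open>\<not>\<not>A\<^sub>T\<close> and \<open>\<not>\<not>A\<close> are
  equivalent for every \<open>A\<close>. Finally DNS is derivable in \<open>MQC\<^sup>+\<close>: after a reset, shift
  eliminates the inner double negation.
\<close>

section \<open>Substitution and its commutation with the translation\<close>

text \<open>Spelled with raw \<open>Imp\<close> instead of \<open>neg\<close>, to match the double
  negations that \<open>trans_sub\<close> inserts.\<close>

abbreviation nn :: "('f, 'p) fm \<Rightarrow> ('f, 'p) fm \<Rightarrow> ('f, 'p) fm" where
  "nn T A \<equiv> Imp (Imp A T) T"

lemma sub_tm_comp: "sub_tm \<sigma> (sub_tm \<tau> t) = sub_tm (\<lambda>i. sub_tm \<sigma> (\<tau> i)) t"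
  by (induction t) auto

lemma sub_tm_Var: "sub_tm Var t = t"
  by (induction t) (auto simp: map_idI)

lemma up_comp: "up (\<lambda>i. sub_tm \<sigma> (\<tau> i)) = (\<lambda>i. sub_tm (up \<sigma>) (up \<tau> i))"
  by (auto simp: fun_eq_iff up_def lift_tm_def sub_tm_comp split: nat.split)

lemma up_Var: "up Var = Var"
  by (auto simp: fun_eq_iff up_def lift_tm_def split: nat.split)

lemma sub_fm_comp: "sub_fm \<sigma> (sub_fm \<tau> A) = sub_fm (\<lambda>i. sub_tm \<sigma> (\<tau> i)) A"
  by (induction A arbitrary: \<sigma> \<tau>) (auto simp: sub_tm_comp up_comp)

lemma sub_fm_Var: "sub_fm Var A = A"
  by (induction A) (auto simp: sub_tm_Var up_Var map_idI)

lemma sub_fm_up_lift: "sub_fm (up \<sigma>) (lift_fm A) = lift_fm (sub_fm \<sigma> A)"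
  by (simp add: lift_fm_def sub_fm_comp up_def lift_tm_def)

lemma inst_lift: "inst (lift_fm A) t = A"
  by (simp add: inst_def lift_fm_def sub_fm_comp sub_fm_Var)

text \<open>Lifting \<open>All A\<close> or \<open>Ex A\<close> shifts every index of the body
  except 0, and instantiating at \<open>Var 0\<close> undoes this. So a lifted quantified formula
  can be used at the eigenvariable to give the original body.\<close>

lemma inst_up_Suc:
  fixes A :: "('f, 'p) fm"
  shows "inst (sub_fm (up (\<lambda>i. Var (Suc i))) A) (Var 0) = A"
proof -
  have "(\<lambda>i. sub_tm (case_nat (Var 0) Var) (up (\<lambda>i. Var (Suc i)) i)) = (Var :: nat \<Rightarrow> 'f tm)"
    by (auto simp: fun_eq_iff up_def lift_tm_def split: nat.split)
  then show ?thesis by (simp only: inst_def sub_fm_comp sub_fm_Var)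
qed

lemma lift_fm_simps:
  "lift_fm (Imp A B) = Imp (lift_fm A) (lift_fm B)"
  "lift_fm (All A) = All (sub_fm (up (\<lambda>i. Var (Suc i))) A)"
  "lift_fm (Ex A) = Ex (sub_fm (up (\<lambda>i. Var (Suc i))) A)"
  by (simp_all add: lift_fm_def)

lemma sigma_sub_fm: "sigma (sub_fm \<sigma> A) = sigma A"
  by (induction A arbitrary: \<sigma>) auto

lemma sigma_lift_fm: "sigma (lift_fm A) = sigma A"
  by (simp add: lift_fm_def sigma_sub_fm)

text \<open>Double negations are inserted only at \<open>Imp\<close> and \<open>All\<close>, which a
  \<Sigma>-formula does not contain.\<close>

lemma trans_sub_sigma: "sigma A \<Longrightarrow> trans_sub T A = A"
  by (induction A arbitrary: T) auto

lemma sub_fm_trans_sub: "sub_fm \<sigma> (trans_sub T A) = trans_sub (sub_fm \<sigma> T) (sub_fm \<sigma> A)"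
  by (induction A arbitrary: \<sigma> T) (auto simp: sub_fm_up_lift)

lemma lift_fm_trans_sub: "lift_fm (trans_sub T A) = trans_sub (lift_fm T) (lift_fm A)"
  by (simp add: lift_fm_def sub_fm_trans_sub)

lemma inst_trans_sub: "inst (trans_sub (lift_fm T) A) t = trans_sub T (inst A t)"
  using inst_lift[of T t] by (simp add: inst_def sub_fm_trans_sub)

lemma inst_Imp: "inst (Imp A B) t = Imp (inst A t) (inst B t)"
  by (simp add: inst_def)

section \<open>Double negation as a monad\<close>

locale implicational =
  fixes D :: "('f, 'p) fm list \<Rightarrow> ('f, 'p) fm \<Rightarrow> bool"
  assumes ax: "A \<in> set \<Gamma> \<Longrightarrow> D \<Gamma> A"
    and impI: "D (A # \<Gamma>) B \<Longrightarrow> D \<Gamma> (Imp A B)"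
    and impE: "D \<Gamma> (Imp A B) \<Longrightarrow> D \<Gamma> A \<Longrightarrow> D \<Gamma> B"
    and weaken: "D \<Gamma> A \<Longrightarrow> set \<Gamma> \<subseteq> set \<Delta> \<Longrightarrow> D \<Delta> A"
begin

lemma nn_return: "D \<Gamma> A \<Longrightarrow> D \<Gamma> (nn T A)"
  by (rule impI, rule impE[where A = A]) (auto intro: ax weaken)

text \<open>Under a double-negated goal, a double negation of \<open>A\<close> may be stripped:
  given a refutation of \<open>C\<close>, the second premise refutes \<open>A\<close>, contradicting
  the first.\<close>

lemma nn_bind:
  assumes "D \<Gamma> (nn T A)" and "D (A # \<Gamma>) (nn T C)"
  shows "D \<Gamma> (nn T C)"
proof (rule impI)
  have "D (A # Imp C T # \<Gamma>) (nn T C)"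
    using assms(2) by (rule weaken) auto
  then have "D (A # Imp C T # \<Gamma>) T"
    by (rule impE) (simp add: ax)
  then have "D (Imp C T # \<Gamma>) (Imp A T)"
    by (rule impI)
  moreover have "D (Imp C T # \<Gamma>) (nn T A)"
    using assms(1) by (rule weaken) auto
  ultimately show "D (Imp C T # \<Gamma>) T"
    using impE by blast
qed

lemma nn_collapse:
  assumes "D \<Gamma> (nn T (nn T A))"
  shows "D \<Gamma> (nn T A)"
  using assms by (rule nn_bind) (simp add: ax)

end

section \<open>Weakening, also covering exchange and contraction of the list contexts\<close>

lemma mqc_weaken: "mqc \<Gamma> A \<Longrightarrow> set \<Gamma> \<subseteq> set \<Delta> \<Longrightarrow> mqc \<Delta> A"
proof (induction arbitrary: \<Delta> rule: mqc.induct)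
  case (DisjE \<Gamma> A B C)
  show ?case
    by (rule mqc.DisjE[of \<Delta> A B C]) (simp_all add: DisjE subset_insertI2)
next
  case (ImpI A \<Gamma> B)
  show ?case by (rule mqc.ImpI) (simp add: ImpI subset_insertI2)
next
  case (AllI \<Gamma> A)
  show ?case by (rule mqc.AllI) (simp add: AllI image_mono)
next
  case (ExE \<Gamma> A C)
  show ?case
    by (rule mqc.ExE[of \<Delta> A C]) (simp_all add: ExE image_mono subset_insertI2)
qed (auto intro: mqc.intros)

lemma mqc_dns_weaken: "mqc_dns T \<Gamma> A \<Longrightarrow> set \<Gamma> \<subseteq> set \<Delta> \<Longrightarrow> mqc_dns T \<Delta> A"
proof (induction arbitrary: \<Delta> rule: mqc_dns.induct)
  case (DisjE T \<Gamma> A B C)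
  show ?case
    by (rule mqc_dns.DisjE[of T \<Delta> A B C]) (simp_all add: DisjE subset_insertI2)
next
  case (ImpI T A \<Gamma> B)
  show ?case by (rule mqc_dns.ImpI) (simp add: ImpI subset_insertI2)
next
  case (AllI T \<Gamma> A)
  show ?case by (rule mqc_dns.AllI) (simp add: AllI image_mono)
next
  case (ExE T \<Gamma> A C)
  show ?case
    by (rule mqc_dns.ExE[of T \<Delta> A C]) (simp_all add: ExE image_mono subset_insertI2)
qed (auto intro: mqc_dns.intros)

interpretation mqc: implicational mqc
  by unfold_locales (auto intro: mqc.intros mqc_weaken)

interpretation mqc_dns: implicational "mqc_dns T" for T
  by unfold_locales (auto intro: mqc_dns.intros mqc_dns_weaken)

lemma mqc_imp_mqc_dns: "mqc \<Gamma> A \<Longrightarrow> mqc_dns T \<Gamma> A"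
  by (induction arbitrary: T rule: mqc.induct) (rule mqc_dns.intros; blast)+

section \<open>Classical logic interpreted in minimal logic\<close>

text \<open>A call-by-value reading: hypotheses are translated by \<open>trans_sub\<close>,
  conclusions carry an extra double negation. Most rules strip the double negations of their
  premises with \<open>nn_bind\<close> and then apply the minimal rule. \<open>sigma T\<close> stays
  in the induction because \<open>T\<close> is lifted at eigenvariables.\<close>

lemma cqc_imp_mqc_trans:
  "cqc T \<Gamma> A \<Longrightarrow> sigma T \<Longrightarrow> mqc (map (trans_sub T) \<Gamma>) (nn T (trans_sub T A))"
proof (induction rule: cqc.induct)
  case (Ax A \<Gamma> T)
  then show ?case by (intro mqc.nn_return mqc.Ax) auto
next
  case (ConjI T \<Gamma> A B)
  let ?A = "trans_sub T A" and ?B = "trans_sub T B" and ?\<Gamma> = "map (trans_sub T) \<Gamma>"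
  have "mqc (?A # ?\<Gamma>) (nn T ?B)"
    using ConjI by (intro mqc_weaken[OF ConjI.IH(2)]) auto
  moreover have "mqc (?B # ?A # ?\<Gamma>) (nn T (Conj ?A ?B))"
    by (intro mqc.nn_return mqc.ConjI mqc.Ax) auto
  ultimately have "mqc (?A # ?\<Gamma>) (nn T (Conj ?A ?B))"
    by (rule mqc.nn_bind)
  then show ?case
    unfolding trans_sub.simps by (rule mqc.nn_bind[OF ConjI.IH(1)[OF ConjI.prems]])
next
  case (ConjE1 T \<Gamma> A B)
  from ConjE1.IH[OF ConjE1.prems] show ?case
    by (rule mqc.nn_bind) (simp, rule mqc.nn_return[OF mqc.ConjE1[OF mqc.Ax[OF list.set_intros(1)]]])
next
  case (ConjE2 T \<Gamma> A B)
  from ConjE2.IH[OF ConjE2.prems] show ?case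
    by (rule mqc.nn_bind) (simp, rule mqc.nn_return[OF mqc.ConjE2[OF mqc.Ax[OF list.set_intros(1)]]])
next
  case (DisjI1 T \<Gamma> A B)
  from DisjI1.IH[OF DisjI1.prems] show ?case
    by (rule mqc.nn_bind) (simp add: mqc.nn_return mqc.DisjI1 mqc.Ax)
next
  case (DisjI2 T \<Gamma> B A)
  from DisjI2.IH[OF DisjI2.prems] show ?case
    by (rule mqc.nn_bind) (simp add: mqc.nn_return mqc.DisjI2 mqc.Ax)
next
  case (DisjE T \<Gamma> A B C)
  let ?A = "trans_sub T A" and ?B = "trans_sub T B" and ?C = "trans_sub T C"
    and ?\<Gamma> = "map (trans_sub T) \<Gamma>"
  have "mqc (Disj ?A ?B # ?\<Gamma>) (nn T ?C)"
  proof (rule mqc.DisjE)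
    show "mqc (Disj ?A ?B # ?\<Gamma>) (Disj ?A ?B)" by (simp add: mqc.Ax)
    show "mqc (?A # Disj ?A ?B # ?\<Gamma>) (nn T ?C)"
      using DisjE.prems by (intro mqc_weaken[OF DisjE.IH(2)]) auto
    show "mqc (?B # Disj ?A ?B # ?\<Gamma>) (nn T ?C)"
      using DisjE.prems by (intro mqc_weaken[OF DisjE.IH(3)]) auto
  qed
  then show ?case
    using DisjE.IH(1)[OF DisjE.prems] unfolding trans_sub.simps by (rule mqc.nn_bind[rotated])
next
  case (ImpI T A \<Gamma> B)
  then show ?case by (auto intro: mqc.nn_return mqc.ImpI)
next
  case (ImpE T \<Gamma> A B)
  let ?A = "trans_sub T A" and ?B = "trans_sub T B" and ?\<Gamma> = "map (trans_sub T) \<Gamma>"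
  have "mqc (?A # Imp ?A (nn T ?B) # ?\<Gamma>) (nn T ?B)"
    by (rule mqc.ImpE[where A = ?A]) (simp_all add: mqc.Ax)
  moreover have "mqc (Imp ?A (nn T ?B) # ?\<Gamma>) (nn T ?A)"
    using ImpE.prems by (intro mqc_weaken[OF ImpE.IH(2)]) auto
  ultimately have "mqc (Imp ?A (nn T ?B) # ?\<Gamma>) (nn T ?B)"
    by (rule mqc.nn_bind[rotated])
  then show ?case
    using ImpE.IH(1)[OF ImpE.prems] unfolding trans_sub.simps by (rule mqc.nn_bind[rotated])
next
  case (AllI T \<Gamma> A)
  then have "mqc (map lift_fm (map (trans_sub T) \<Gamma>)) (nn (lift_fm T) (trans_sub (lift_fm T) A))"
    by (simp add: sigma_lift_fm comp_def lift_fm_trans_sub)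
  then show ?case
    unfolding trans_sub.simps by (rule mqc.nn_return[OF mqc.AllI])
next
  case (AllE T \<Gamma> A t)
  let ?A = "All (nn (lift_fm T) (trans_sub (lift_fm T) A))"
  have "mqc (?A # map (trans_sub T) \<Gamma>) (inst (nn (lift_fm T) (trans_sub (lift_fm T) A)) t)"
    by (simp add: mqc.AllE mqc.Ax)
  then have "mqc (?A # map (trans_sub T) \<Gamma>) (nn T (trans_sub T (inst A t)))"
    by (simp add: inst_Imp inst_lift inst_trans_sub)
  then show ?case
    using AllE.IH[OF AllE.prems] unfolding trans_sub.simps by (rule mqc.nn_bind[rotated])
next
  case (ExI T \<Gamma> A t)
  have "mqc (trans_sub T (inst A t) # map (trans_sub T) \<Gamma>) (trans_sub T (Ex A))"
    unfolding trans_sub.simps by (rule mqc.ExI[where t = t]) (simp add: inst_trans_sub mqc.Ax)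
  from ExI.IH[OF ExI.prems] mqc.nn_return[OF this] show ?case
    by (rule mqc.nn_bind)
next
  case (ExE T \<Gamma> A C)
  let ?A = "trans_sub (lift_fm T) A" and ?C = "trans_sub T C" and ?\<Gamma> = "map (trans_sub T) \<Gamma>"
  have "mqc (?A # map lift_fm ?\<Gamma>) (lift_fm (nn T ?C))"
    using ExE by (simp add: sigma_lift_fm comp_def lift_fm_trans_sub lift_fm_simps)
  \<comment> \<open>The extra hypothesis \<open>Ex ?A\<close> is the one that the final bind will
    discharge.\<close>
  then have "mqc (?A # map lift_fm (Ex ?A # ?\<Gamma>)) (lift_fm (nn T ?C))"
    by (rule mqc_weaken) auto
  then have "mqc (Ex ?A # ?\<Gamma>) (nn T ?C)"
    by (rule mqc.ExE[rotated]) (simp add: mqc.Ax)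
  then show ?case
    using ExE.IH(1)[OF ExE.prems] unfolding trans_sub.simps by (rule mqc.nn_bind[rotated])
next
  case (EFQ T \<Gamma> A)
  have "mqc (map (trans_sub T) \<Gamma>) (Imp T (nn T (trans_sub T A)))"
    by (rule mqc.ImpI[OF mqc.ImpI[OF mqc.Ax]]) simp
  from mqc.nn_return[OF this] EFQ show ?case
    by (simp add: trans_sub_sigma)
next
  case (DNE T \<Gamma> A)
  let ?A = "trans_sub T A" and ?\<Gamma> = "map (trans_sub T) \<Gamma>"
  \<comment> \<open>The translation of the double negation of \<open>A\<close>, using that
    \<open>T\<close> is its own translation.\<close>
  let ?H = "Imp (Imp ?A (nn T T)) (nn T T)"
  let ?\<Delta> = "Imp ?A T # ?H # ?\<Gamma>"
  have "mqc (?A # ?\<Delta>) T"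
    by (rule mqc.ImpE[where A = ?A]) (simp_all add: mqc.Ax)
  then have "mqc ?\<Delta> (Imp ?A (nn T T))"
    by (intro mqc.ImpI mqc.nn_return)
  then have "mqc ?\<Delta> (nn T T)"
    by (rule mqc.ImpE[rotated]) (simp add: mqc.Ax)
  \<comment> \<open>The double negation of \<open>T\<close> is applied to the identity on
    \<open>T\<close>.\<close>
  then have "mqc ?\<Delta> T"
    by (rule mqc.ImpE) (simp add: mqc.ImpI mqc.Ax)
  then have "mqc (?H # ?\<Gamma>) (nn T ?A)"
    by (rule mqc.ImpI)
  moreover have "mqc ?\<Gamma> (nn T ?H)"
    using DNE by (simp add: neg_def trans_sub_sigma)
  ultimately show ?case
    by (rule mqc.nn_bind[rotated])
qed

section \<open>Equivalence of a formula with its translation under DNS\<close>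

lemma mqc_dns_shift_All:
  assumes "mqc_dns T \<Gamma> (All (nn (lift_fm T) A))"
  shows "mqc_dns T \<Gamma> (nn T (All A))"
proof (rule mqc_dns.ImpE[OF _ assms], rule mqc_dns.DNS)
  show "Imp (All (nn (lift_fm T) A)) (nn T (All A)) \<in> DNS T"
    by (auto simp: DNS_def neg_def)
qed

lemma mqc_dns_shift_Imp:
  assumes "mqc_dns T \<Gamma> (Imp A (nn T B))"
  shows "mqc_dns T \<Gamma> (nn T (Imp A B))"
proof (rule mqc_dns.ImpE[OF _ assms], rule mqc_dns.DNS)
  show "Imp (Imp A (nn T B)) (nn T (Imp A B)) \<in> DNS T"
    by (auto simp: DNS_def neg_def)
qed

text \<open>The lifted \<open>All A\<close> is instantiated at the eigenvariable. The first premise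
  ranges over all contexts so that an induction hypothesis fits it directly.\<close>

lemma mqc_dns_All_mono:
  assumes "\<And>\<Gamma>. A \<in> set \<Gamma> \<Longrightarrow> mqc_dns (lift_fm T) \<Gamma> B" and "All A \<in> set \<Gamma>"
  shows "mqc_dns T \<Gamma> (All B)"
proof (rule mqc_dns.AllI)
  have "lift_fm (All A) \<in> set (map lift_fm \<Gamma>)"
    using assms(2) by simp
  then have "mqc_dns (lift_fm T) (map lift_fm \<Gamma>) (inst (sub_fm (up (\<lambda>i. Var (Suc i))) A) (Var 0))"
    unfolding lift_fm_simps by (intro mqc_dns.AllE mqc_dns.Ax)
  then have "mqc_dns (lift_fm T) (map lift_fm \<Gamma>) A"
    by (simp only: inst_up_Suc)
  moreover have "mqc_dns (lift_fm T) (map lift_fm \<Gamma>) (Imp A B)"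
    by (intro mqc_dns.ImpI assms(1)) simp
  ultimately show "mqc_dns (lift_fm T) (map lift_fm \<Gamma>) B"
    using mqc_dns.ImpE by blast
qed

text \<open>The eigenvariable standing for the witness of \<open>A\<close> also witnesses
  \<open>B\<close>, once the double negation of \<open>B\<close> is stripped.\<close>

lemma mqc_dns_Ex_nn:
  assumes "Ex A \<in> set \<Gamma>" and "\<And>\<Gamma>. A \<in> set \<Gamma> \<Longrightarrow> mqc_dns (lift_fm T) \<Gamma> (nn (lift_fm T) B)"
  shows "mqc_dns T \<Gamma> (nn T (Ex B))"
proof (rule mqc_dns.ExE)
  show "mqc_dns T \<Gamma> (Ex A)" using assms(1) by (rule mqc_dns.Ax)
  let ?B = "sub_fm (up (\<lambda>i. Var (Suc i))) B"
  have "mqc_dns (lift_fm T) (A # map lift_fm \<Gamma>) (nn (lift_fm T) B)"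
    by (simp add: assms(2))
  moreover have "mqc_dns (lift_fm T) (B # A # map lift_fm \<Gamma>) (nn (lift_fm T) (Ex ?B))"
    by (intro mqc_dns.nn_return mqc_dns.ExI[where t = "Var 0"] mqc_dns.Ax) (simp add: inst_up_Suc)
  ultimately show "mqc_dns (lift_fm T) (A # map lift_fm \<Gamma>) (lift_fm (nn T (Ex B)))"
    unfolding lift_fm_simps by (rule mqc_dns.nn_bind)
qed

text \<open>The primed formulas may be the translations of the unprimed ones or conversely, so one
  lemma serves both directions of the equivalence.\<close>

lemma mqc_dns_Conj_nn:
  assumes "Conj A B \<in> set \<Gamma>"
    and A: "\<And>\<Gamma>. A \<in> set \<Gamma> \<Longrightarrow> mqc_dns T \<Gamma> (nn T A')"
    and B: "\<And>\<Gamma>. B \<in> set \<Gamma> \<Longrightarrow> mqc_dns T \<Gamma> (nn T B')"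
  shows "mqc_dns T \<Gamma> (nn T (Conj A' B'))"
proof -
  have "mqc_dns T (A' # B # A # \<Gamma>) (nn T (Conj A' B'))"
    by (rule mqc_dns.nn_bind[OF B[of "A' # B # A # \<Gamma>"]])
      (simp_all add: mqc_dns.nn_return mqc_dns.ConjI mqc_dns.Ax)
  then have "mqc_dns T (B # A # \<Gamma>) (nn T (Conj A' B'))"
    by (rule mqc_dns.nn_bind[rotated]) (simp add: A)
  then have "mqc_dns T \<Gamma> (Imp A (Imp B (nn T (Conj A' B'))))"
    by (rule mqc_dns.ImpI[OF mqc_dns.ImpI])
  with mqc_dns.Ax[OF assms(1)] show ?thesis
    by (meson mqc_dns.ConjE1 mqc_dns.ConjE2 mqc_dns.ImpE)
qed

lemma mqc_dns_Disj_nn: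
  assumes "Disj A B \<in> set \<Gamma>"
    and A: "\<And>\<Gamma>. A \<in> set \<Gamma> \<Longrightarrow> mqc_dns T \<Gamma> (nn T A')"
    and B: "\<And>\<Gamma>. B \<in> set \<Gamma> \<Longrightarrow> mqc_dns T \<Gamma> (nn T B')"
  shows "mqc_dns T \<Gamma> (nn T (Disj A' B'))"
proof (rule mqc_dns.DisjE)
  show "mqc_dns T \<Gamma> (Disj A B)" using assms(1) by (rule mqc_dns.Ax)
  show "mqc_dns T (A # \<Gamma>) (nn T (Disj A' B'))"
    by (rule mqc_dns.nn_bind[OF A[of "A # \<Gamma>"]])
      (simp_all add: mqc_dns.nn_return mqc_dns.DisjI1 mqc_dns.Ax)
  show "mqc_dns T (B # \<Gamma>) (nn T (Disj A' B'))"
    by (rule mqc_dns.nn_bind[OF B[of "B # \<Gamma>"]])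
      (simp_all add: mqc_dns.nn_return mqc_dns.DisjI2 mqc_dns.Ax)
qed

text \<open>Chains \<open>A'\<close> to \<open>A\<close> to \<open>B\<close> to \<open>B'\<close> by
  binding, with the step between antecedents reversed.\<close>

lemma mqc_dns_Imp_nn:
  assumes "Imp A (nn T B) \<in> set \<Gamma>"
    and A: "\<And>\<Gamma>. A' \<in> set \<Gamma> \<Longrightarrow> mqc_dns T \<Gamma> (nn T A)"
    and B: "\<And>\<Gamma>. B \<in> set \<Gamma> \<Longrightarrow> mqc_dns T \<Gamma> (nn T B')"
  shows "mqc_dns T \<Gamma> (Imp A' (nn T B'))"
proof -
  have "mqc_dns T (A # A' # \<Gamma>) (nn T B)"
    by (rule mqc_dns.ImpE[where A = A]) (simp_all add: mqc_dns.Ax assms(1))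
  then have "mqc_dns T (A # A' # \<Gamma>) (nn T B')"
    by (rule mqc_dns.nn_bind) (simp add: B)
  then have "mqc_dns T (A' # \<Gamma>) (nn T B')"
    by (rule mqc_dns.nn_bind[rotated]) (simp add: A)
  then show ?thesis by (rule mqc_dns.ImpI)
qed

text \<open>The two directions need each other at implications, where the premise is contravariant.\<close>

lemma mqc_dns_trans_sub:
  "(A \<in> set \<Gamma> \<longrightarrow> mqc_dns T \<Gamma> (nn T (trans_sub T A))) \<and>
   (trans_sub T A \<in> set \<Gamma> \<longrightarrow> mqc_dns T \<Gamma> (nn T A))"
proof (induction A arbitrary: T \<Gamma>)
  case (Atom p ts)
  then show ?case by (simp add: mqc_dns.nn_return mqc_dns.Ax)
next
  case (Conj A B)
  then show ?case by (auto elim: mqc_dns_Conj_nn)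
next
  case (Disj A B)
  then show ?case by (auto elim: mqc_dns_Disj_nn)
next
  case (Imp A B)
  show ?case
  proof (intro conjI impI)
    assume "Imp A B \<in> set \<Gamma>"
    then have "mqc_dns T (A # \<Gamma>) B"
      by (intro mqc_dns.ImpE[where A = A and B = B]) (simp_all add: mqc_dns.Ax)
    \<comment> \<open>The conclusion is double negated to give the shape that
      \<open>mqc_dns_Imp_nn\<close> expects.\<close>
    then have "mqc_dns T \<Gamma> (Imp A (nn T B))"
      by (intro mqc_dns.ImpI mqc_dns.nn_return)
    moreover have "mqc_dns T \<Gamma> (Imp (Imp A (nn T B)) (Imp (trans_sub T A) (nn T (trans_sub T B))))"
      by (rule mqc_dns.ImpI, rule mqc_dns_Imp_nn[OF list.set_intros(1)]) (simp_all add: Imp)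
    ultimately show "mqc_dns T \<Gamma> (nn T (trans_sub T (Imp A B)))"
      by (auto intro: mqc_dns.nn_return mqc_dns.ImpE)
  next
    assume "trans_sub T (Imp A B) \<in> set \<Gamma>"
    then have "mqc_dns T \<Gamma> (Imp A (nn T B))"
      by (intro mqc_dns_Imp_nn[where A = "trans_sub T A" and B = "trans_sub T B"])
        (simp_all add: Imp)
    \<comment> \<open>The double negation sits on the conclusion only; the implicational instance of
      DNS moves it in front.\<close>
    then show "mqc_dns T \<Gamma> (nn T (Imp A B))" by (rule mqc_dns_shift_Imp)
  qed
next
  case (Ex A)
  then show ?case by (auto elim: mqc_dns_Ex_nn)
next
  case (All A)
  show ?case
  proof (intro conjI impI)
    let ?A = "nn (lift_fm T) (trans_sub (lift_fm T) A)"
    assume "All A \<in> set \<Gamma>"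
    then have "mqc_dns T \<Gamma> (All ?A)"
      by (rule mqc_dns_All_mono[rotated]) (simp add: All)
    then show "mqc_dns T \<Gamma> (nn T (trans_sub T (All A)))"
      unfolding trans_sub.simps by (rule mqc_dns.nn_return)
  next
    let ?T = "lift_fm T"
    let ?A = "trans_sub ?T A"
    assume "trans_sub T (All A) \<in> set \<Gamma>"
    then have "All (nn ?T ?A) \<in> set \<Gamma>" by simp
    \<comment> \<open>The induction hypothesis removes the translation below the quantifier; the
      double negation left there is moved out by DNS afterwards.\<close>
    moreover have "mqc_dns ?T \<Delta> (nn ?T A)" if "nn ?T ?A \<in> set \<Delta>" for \<Delta>
      by (rule mqc_dns.nn_bind[where A = ?A]) (simp_all add: All that mqc_dns.Ax)
    ultimately have "mqc_dns T \<Gamma> (All (nn ?T A))"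
      by (rule mqc_dns_All_mono[rotated])
    then show "mqc_dns T \<Gamma> (nn T (All A))" by (rule mqc_dns_shift_All)
  qed
qed

lemma mqc_dns_nn_trans_sub:
  assumes "mqc_dns T \<Gamma> (nn T (trans_sub T A))"
  shows "mqc_dns T \<Gamma> (nn T A)"
  using assms by (rule mqc_dns.nn_bind) (simp add: mqc_dns_trans_sub)

section \<open>Shift and reset: deriving DNS, and classical soundness\<close>

text \<open>Shift supplies the hypothesis \<open>Imp A T\<close>, which the double negation in the
  context turns into \<open>T\<close>.\<close>

lemma mqc_plus_shift_nn:
  assumes "nn T A \<in> set \<Gamma>"
  shows "mqc_plus T Annotated \<Gamma> A"
  by (rule mqc_plus.Shift, rule mqc_plus.ImpE[where A = "Imp A T"])
    (simp_all add: assms mqc_plus.Ax)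

lemma mqc_plus_DNS:
  assumes "A \<in> DNS T"
  shows "mqc_plus T d \<Gamma> A"
proof -
  \<comment> \<open>After the two introductions the goal is \<open>T\<close>, so reset applies;
    above it the derivation is annotated, shift becomes available, and the hypothesis refuting
    \<open>C\<close> reduces the goal to \<open>C\<close>.\<close>
  have nn_intro: "mqc_plus T d \<Gamma> (Imp H (nn T C))"
    if "mqc_plus T Annotated (Imp C T # H # \<Gamma>) C" for H C
    using mqc_plus.ImpI[OF mqc_plus.ImpI[OF mqc_plus.Reset[OF mqc_plus.ImpE[OF mqc_plus.Ax that]]]]
    by simp
  from assms consider B where "A = Imp (All (nn (lift_fm T) B)) (nn T (All B))"
    | B C where "A = Imp (Imp B (nn T C)) (nn T (Imp B C))"
    by (auto simp: DNS_def neg_def)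
  then show ?thesis
  proof cases
    case 1
    let ?T = "lift_fm T" and ?H = "All (nn (lift_fm T) B)"
    let ?\<Gamma> = "map lift_fm (Imp (All B) T # ?H # \<Gamma>)"
    \<comment> \<open>The body of the lifted \<open>?H\<close>, to be instantiated at the
      eigenvariable.\<close>
    let ?H' = "sub_fm (up (\<lambda>i. Var (Suc i))) (nn ?T B)"
    have "mqc_plus ?T Annotated ?\<Gamma> (inst ?H' (Var 0))"
      by (intro mqc_plus.AllE mqc_plus.Ax) (simp add: lift_fm_simps)
    then have "mqc_plus ?T Annotated ?\<Gamma> (nn ?T B)"
      by (simp only: inst_up_Suc)
    moreover have "mqc_plus ?T Annotated ?\<Gamma> (Imp (nn ?T B) B)"
      by (intro mqc_plus.ImpI mqc_plus_shift_nn) simp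
    ultimately have "mqc_plus ?T Annotated ?\<Gamma> B"
      using mqc_plus.ImpE by blast
    then show ?thesis
      unfolding 1 by (rule nn_intro[OF mqc_plus.AllI])
  next
    case 2
    let ?\<Gamma> = "B # Imp (Imp B C) T # Imp B (nn T C) # \<Gamma>"
    have "mqc_plus T Annotated ?\<Gamma> (nn T C)"
      by (rule mqc_plus.ImpE[where A = B]) (simp_all add: mqc_plus.Ax)
    moreover have "mqc_plus T Annotated ?\<Gamma> (Imp (nn T C) C)"
      by (intro mqc_plus.ImpI mqc_plus_shift_nn) simp
    ultimately have "mqc_plus T Annotated ?\<Gamma> C"
      using mqc_plus.ImpE by blast
    then show ?thesis
      unfolding 2 by (rule nn_intro[OF mqc_plus.ImpI])
  qed
qed

lemma mqc_dns_imp_mqc_plus: "mqc_dns T \<Gamma> A \<Longrightarrow> mqc_plus T d \<Gamma> A"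
  by (induction rule: mqc_dns.induct) ((rule mqc_plus.intros; assumption) | rule mqc_plus_DNS)+

text \<open>With annotations forgotten, shift is proof by contradiction and reset repeats its
  premise.\<close>

lemma mqc_plus_imp_cqc: "mqc_plus T d \<Gamma> A \<Longrightarrow> cqc T \<Gamma> A"
proof (induction rule: mqc_plus.induct)
  case (Shift T A \<Gamma>)
  show ?case
    by (rule cqc.DNE, unfold neg_def, rule cqc.ImpI, rule Shift.IH)
qed (rule cqc.intros; assumption)+

section \<open>The cycle of implications\<close>

theorem corollary3p7:
  fixes T A :: "('f, 'p) fm"
  assumes "sigma T"
  shows "(mqc_plus T Plain [] (neg T (neg T A)) \<longrightarrow> mqc [] (trans_sup T (neg T (neg T A)))) \<and>
    (mqc [] (trans_sup T (neg T (neg T A))) \<longleftrightarrow> cqc T [] A) \<and>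
    (mqc [] (trans_sup T (neg T (neg T A))) \<longrightarrow>
       mqc_dns T [] (neg T (neg T (neg T (neg T A))))) \<and>
    (mqc_dns T [] (neg T (neg T (neg T (neg T A)))) \<longrightarrow> mqc_dns T [] (neg T (neg T A))) \<and>
    (mqc_dns T [] (neg T (neg T A)) \<longrightarrow> mqc_plus T Plain [] (neg T (neg T A))) \<and>
    (mqc_plus T Plain [] (neg T (neg T A)) \<longleftrightarrow> cqc T [] A)"
proof -
  let ?B = "nn T A"
  \<comment> \<open>Kept general in \<open>C\<close>, since it is used both for \<open>A\<close> and
    for its double negation.\<close>
  have mqc: "mqc [] (nn T (trans_sub T C))" if "cqc T [] C" for C
    using cqc_imp_mqc_trans[OF that assms] by simp
  have plus: "mqc_plus T Plain [] ?B" if "cqc T [] A"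
    by (rule mqc_dns_imp_mqc_plus[OF mqc_dns_nn_trans_sub[OF mqc_imp_mqc_dns[OF mqc[OF that]]]])
  have cqc: "cqc T [] A" if "mqc_plus T Plain [] ?B"
    using mqc_plus_imp_cqc[OF that] unfolding neg_def[symmetric] by (rule cqc.DNE)
  have trans: "mqc [] (nn T (trans_sub T ?B))" if "mqc_plus T Plain [] ?B"
    using mqc_plus_imp_cqc[OF that] by (rule mqc)
  \<comment> \<open>The translation is removed from the double negation of \<open>A\<close> as a
    whole, which leaves four negations.\<close>
  have dns: "mqc_dns T [] (nn T ?B)" if "mqc [] (nn T (trans_sub T ?B))"
    using that by (rule mqc_dns_nn_trans_sub[OF mqc_imp_mqc_dns])
  have collapse: "mqc_dns T [] ?B" if "mqc_dns T [] (nn T ?B)"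
    using that by (rule mqc_dns.nn_collapse)
  have "mqc_plus T Plain [] ?B" if "mqc_dns T [] ?B"
    using that by (rule mqc_dns_imp_mqc_plus)
  \<comment> \<open>Both equivalences come from going round the cycle: \<open>dns\<close>,
    \<open>collapse\<close>, the last fact and \<open>cqc\<close> lead from the translated formula
    to classical derivability, while \<open>plus\<close> and \<open>trans\<close> lead back.\<close>
  then show ?thesis
    unfolding neg_def trans_sup_def using plus cqc trans dns collapse by blast
qed

end
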